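(* Let $R$ be a monotone transit function on a finite non-empty set $V$ satisfying $(a')$ and $(k)$, and let $\mathscr{C}_R=\{R(x,y):x,y\in V\}$ be its system of transit sets. Then $\mathscr{C}_R$ is a convex geometry if and only if $(cg)$ holds for $R$.
   Context: A transit function on a finite non-empty set $V$ is a map $R:V\times V\to 2^V$ such that $u\in R(u,v)$, $R(u,v)=R(v,u)$ and $R(u,u)=\{u\}$ for all $u,v\in V$. It is monotone if for all $u,v,x,y\in V$, $x,y\in R(u,v)$ implies $R(x,y)\subseteq R(u,v)$. A convexity on the finite set $V$ is a family of subsets of $V$ (called convex sets) containing $\emptyset$ and $V$ and closed under intersections; the convex hull of $A\subseteq V$ is the smallest convex set containing $A$. A point $k$ of a convex set $K$ is an extreme point of $K$ if $K\setminus\{k\}$ is convex. A convexity is a convex geometry if every convex set $K$ is the convex hull of the set of extreme points of $K$. A system $\mathscr{C}$ of non-empty subsets of $V$ is regarded as a convexity (respectively a convex geometry) if $\mathscr{C}\cup\{\emptyset\}$ is one. Axioms on $R$: - $(a')$: there exist $u,v\in V$ such that $R(u,v)=V$. - $(k)$: for all $u,v,x,y\in V$ with $R(u,v)\cap R(x,y)\neq\emptyset$, there are $p,q\in V$ such that $R(u,v)\cap R(x,y)=R(p,q)$. - $(cg)$: for all $x,y\in V$ with $R(x,y)\neq V$, there exist $z\in R(x,y)$ and $w\in V\setminus R(x,y)$ such that $R(x,y)\cup\{w\}=R(w,z)$. *)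

theory Defs
  imports Main "HOL.Hull"
begin

text \<open>
  The ground set is an explicit carrier \<open>V\<close>; a map on \<open>V \<times> V\<close> is a curried function whose values
  are constrained (and used) for arguments in \<open>V\<close> only.
\<close>

definition transit_function :: "'a set \<Rightarrow> ('a \<Rightarrow> 'a \<Rightarrow> 'a set) \<Rightarrow> bool" where
  "transit_function V R \<longleftrightarrow>
     (\<forall>u\<in>V. \<forall>v\<in>V. R u v \<subseteq> V \<and> u \<in> R u v \<and> R u v = R v u) \<and> (\<forall>u\<in>V. R u u = {u})"

definition monotone_transit :: "'a set \<Rightarrow> ('a \<Rightarrow> 'a \<Rightarrow> 'a set) \<Rightarrow> bool" where
  "monotone_transit V R \<longleftrightarrow>
     (\<forall>u\<in>V. \<forall>v\<in>V. \<forall>x\<in>V. \<forall>y\<in>V. x \<in> R u v \<and> y \<in> R u v \<longrightarrow> R x y \<subseteq> R u v)"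

definition transit_sets :: "'a set \<Rightarrow> ('a \<Rightarrow> 'a \<Rightarrow> 'a set) \<Rightarrow> 'a set set" where
  "transit_sets V R = {R x y | x y. x \<in> V \<and> y \<in> V}"

definition axiom_a' :: "'a set \<Rightarrow> ('a \<Rightarrow> 'a \<Rightarrow> 'a set) \<Rightarrow> bool" where
  "axiom_a' V R \<longleftrightarrow> (\<exists>u\<in>V. \<exists>v\<in>V. R u v = V)"

definition axiom_k :: "'a set \<Rightarrow> ('a \<Rightarrow> 'a \<Rightarrow> 'a set) \<Rightarrow> bool" where
  "axiom_k V R \<longleftrightarrow>
     (\<forall>u\<in>V. \<forall>v\<in>V. \<forall>x\<in>V. \<forall>y\<in>V. R u v \<inter> R x y \<noteq> {} \<longrightarrow>
        (\<exists>p\<in>V. \<exists>q\<in>V. R u v \<inter> R x y = R p q))"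

definition axiom_cg :: "'a set \<Rightarrow> ('a \<Rightarrow> 'a \<Rightarrow> 'a set) \<Rightarrow> bool" where
  "axiom_cg V R \<longleftrightarrow>
     (\<forall>x\<in>V. \<forall>y\<in>V. R x y \<noteq> V \<longrightarrow>
        (\<exists>z\<in>R x y. \<exists>w\<in>V - R x y. R x y \<union> {w} = R w z))"

text \<open>The intersection of the empty family is \<open>V\<close>, hence the restriction to nonempty families.\<close>

definition convexity :: "'a set \<Rightarrow> 'a set set \<Rightarrow> bool" where
  "convexity V C \<longleftrightarrow>
     C \<subseteq> Pow V \<and> {} \<in> C \<and> V \<in> C \<and> (\<forall>F. F \<subseteq> C \<and> F \<noteq> {} \<longrightarrow> \<Inter>F \<in> C)"

definition extreme_points :: "'a set set \<Rightarrow> 'a set \<Rightarrow> 'a set" where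
  "extreme_points C K = {k \<in> K. K - {k} \<in> C}"

text \<open>
  The library's \<open>S hull A\<close> is the intersection of all sets with property \<open>S\<close> that include \<open>A\<close>;
  for a convexity and \<open>A \<subseteq> V\<close> it is the smallest convex set including \<open>A\<close>.
\<close>

definition convex_geometry :: "'a set \<Rightarrow> 'a set set \<Rightarrow> bool" where
  "convex_geometry V C \<longleftrightarrow>
     convexity V C \<and> (\<forall>K\<in>C. K = (\<lambda>X. X \<in> C) hull (extreme_points C K))"

end

theory Submission
  imports Defs
begin

text \<open>
  A convexity on a finite set is a convex geometry iff every proper convex set extends to a convex
  set by a single point. For one direction, a minimal convex set properly including \<open>K\<close> has an extreme
  point outside \<open>K\<close>, and by minimality this is its only point outside \<open>K\<close>. For the other, if
  the hull \<open>H\<close> of the extreme points of \<open>K\<close> misses a point of \<open>K\<close>, then a maximal convex set that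
  includes \<open>H\<close> but not \<open>K\<close> and its one-point extension exhibit an extreme point of \<open>K\<close> outside \<open>H\<close>.
  Axiom (k) makes the transit sets a convexity; there a one-point extension \<open>K \<union> {w} = R(p,q)\<close> has \<open>w \<in> {p,q}\<close>
  by monotonicity, which turns the extension property into (cg).
\<close>

lemma convexity_Inter:
  assumes "convexity V C" "F \<subseteq> C" "F \<noteq> {}"
  shows "\<Inter>F \<in> C"
  using assms by (simp add: convexity_def)

lemma convexity_Int:
  assumes "convexity V C" "A \<in> C" "B \<in> C"
  shows "A \<inter> B \<in> C"
  using convexity_Inter[OF assms(1), of "{A, B}"] assms(2,3) by simp

text \<open>The convex superset \<open>K\<close> makes the family intersected by the hull nonempty;
  closure under intersections is granted for nonempty families only.\<close>

lemma convexity_hull_mem: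
  assumes "convexity V C" "K \<in> C" "A \<subseteq> K"
  shows "(\<lambda>X. X \<in> C) hull A \<in> C"
proof -
  let ?F = "{X. X \<in> C \<and> A \<subseteq> X}"
  have "?F \<subseteq> C" "?F \<noteq> {}"
    using assms by auto
  then have "\<Inter>?F \<in> C"
    by (rule convexity_Inter[OF assms(1)])
  then show ?thesis by (simp add: hull_def)
qed

lemma convex_geometry_imp_extension:
  assumes "finite V" and cg: "convex_geometry V C" and K: "K \<in> C" "K \<noteq> V"
  shows "\<exists>w\<in>V - K. insert w K \<in> C"
proof -
  have C: "C \<subseteq> Pow V" "V \<in> C"
    using cg unfolding convex_geometry_def convexity_def by auto
  let ?F = "{L \<in> C. K \<subset> L}"
  have "finite ?F"
    using C(1) \<open>finite V\<close> by (simp add: finite_subset)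
  moreover have "?F \<noteq> {}"
    using C K by auto
  ultimately have "\<exists>L\<in>?F. \<forall>M\<in>?F. M \<subseteq> L \<longrightarrow> L = M"
    by (rule finite_has_minimal)
  then obtain L where L: "L \<in> C" "K \<subset> L"
      and min: "\<And>M. M \<in> C \<Longrightarrow> K \<subset> M \<Longrightarrow> M \<subseteq> L \<Longrightarrow> L = M"
    by auto
  \<comment> \<open>Otherwise the convex set \<open>K\<close> would include the hull of these
    points, which is \<open>L\<close> itself.\<close>
  have "\<not> extreme_points C L \<subseteq> K"
  proof
    assume "extreme_points C L \<subseteq> K"
    then have "(\<lambda>X. X \<in> C) hull extreme_points C L \<subseteq> K"
      using K(1) by (simp add: hull_minimal)
    moreover have "L = (\<lambda>X. X \<in> C) hull extreme_points C L"
      using cg L(1) unfolding convex_geometry_def by blast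
    ultimately show False using L(2) by auto
  qed
  then obtain e where e: "e \<in> L" "L - {e} \<in> C" "e \<notin> K"
    unfolding extreme_points_def by blast
  \<comment> \<open>The convex set \<open>L - {e}\<close> still includes \<open>K\<close>, so
    minimality of \<open>L\<close> forces it to equal \<open>K\<close>.\<close>
  have "\<not> K \<subset> L - {e}"
    using min[OF e(2)] e(1) by auto
  then have "insert e K = L"
    using L(2) e by auto
  then show ?thesis
    using e L(1) C(1) by auto
qed

lemma extension_imp_convex_geometry:
  assumes "finite V" and conv: "convexity V C"
    and ext: "\<And>K. K \<in> C \<Longrightarrow> K \<noteq> V \<Longrightarrow> \<exists>w\<in>V - K. insert w K \<in> C"
  shows "convex_geometry V C"
  unfolding convex_geometry_def
proof (intro conjI ballI)
  show "convexity V C" by (fact conv)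
next
  fix K assume K: "K \<in> C"
  have C: "C \<subseteq> Pow V"
    using conv unfolding convexity_def by auto
  define H where "H = (\<lambda>X. X \<in> C) hull extreme_points C K"
  have sub: "extreme_points C K \<subseteq> K"
    unfolding extreme_points_def by auto
  have HC: "H \<in> C"
    unfolding H_def using conv K sub by (rule convexity_hull_mem)
  have HK: "H \<subseteq> K"
    unfolding H_def using sub K by (rule hull_minimal)
  have extH: "extreme_points C K \<subseteq> H"
    unfolding H_def by (rule hull_subset)
  have "K \<subseteq> H"
  proof (rule ccontr)
    assume "\<not> K \<subseteq> H"
    let ?F = "{M \<in> C. H \<subseteq> M \<and> \<not> K \<subseteq> M}"
    have "finite ?F"
      using C \<open>finite V\<close> by (simp add: finite_subset)
    moreover have "?F \<noteq> {}"
      using HC \<open>\<not> K \<subseteq> H\<close> by auto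
    ultimately have "\<exists>M\<in>?F. \<forall>N\<in>?F. M \<subseteq> N \<longrightarrow> M = N"
      by (rule finite_has_maximal)
    then obtain M where M: "M \<in> C" "H \<subseteq> M" "\<not> K \<subseteq> M"
        and max: "\<And>N. N \<in> ?F \<Longrightarrow> M \<subseteq> N \<Longrightarrow> M = N"
      by auto
    have "M \<noteq> V" using M(3) K C by auto
    then obtain w where w: "w \<in> V - M" "insert w M \<in> C"
      using ext M(1) by blast
    \<comment> \<open>A convex set that includes \<open>H\<close> and is strictly larger than the
      maximal \<open>M\<close> has to include \<open>K\<close>.\<close>
    have "K \<subseteq> insert w M"
      using max[of "insert w M"] w M(2) by blast
    \<comment> \<open>Thus \<open>w\<close> is the only point of \<open>K\<close> outside
      \<open>M\<close>, and cutting \<open>K\<close> with \<open>M\<close> removes exactly this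
      point.\<close>
    then have "K \<inter> M = K - {w}" "w \<in> K"
      using M(3) w(1) by auto
    then have "w \<in> extreme_points C K"
      using convexity_Int[OF conv K M(1)] unfolding extreme_points_def by auto
    then show False using extH M(2) w(1) by auto
  qed
  then show "K = (\<lambda>X. X \<in> C) hull extreme_points C K"
    using HK unfolding H_def by auto
qed

lemma convex_geometry_iff_extension:
  assumes "finite V" "convexity V C"
  shows "convex_geometry V C \<longleftrightarrow> (\<forall>K\<in>C. K \<noteq> V \<longrightarrow> (\<exists>w\<in>V - K. insert w K \<in> C))"
proof
  assume "convex_geometry V C"
  then show "\<forall>K\<in>C. K \<noteq> V \<longrightarrow> (\<exists>w\<in>V - K. insert w K \<in> C)"
    by (intro ballI impI) (rule convex_geometry_imp_extension[OF \<open>finite V\<close>])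
next
  assume ext: "\<forall>K\<in>C. K \<noteq> V \<longrightarrow> (\<exists>w\<in>V - K. insert w K \<in> C)"
  show "convex_geometry V C"
    by (rule extension_imp_convex_geometry[OF assms]) (rule ext[rule_format])
qed

lemma ball_transit_sets:
  "(\<forall>K\<in>transit_sets V R. P K) \<longleftrightarrow> (\<forall>x\<in>V. \<forall>y\<in>V. P (R x y))"
  unfolding transit_sets_def by auto

text \<open>Axiom (k) handles two transit sets that meet, and the added empty set absorbs disjoint
  pairs. Since \<open>V\<close> is finite, induction passes from pairs to all nonempty
  families.\<close>

lemma convexity_transit_sets:
  assumes "finite V" and tf: "transit_function V R" and "axiom_a' V R" and k: "axiom_k V R"
  shows "convexity V (transit_sets V R \<union> {{}})" (is "convexity V ?C")
proof -
  have sub: "?C \<subseteq> Pow V"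
    using tf unfolding transit_sets_def transit_function_def by auto
  have V: "V \<in> ?C"
    using \<open>axiom_a' V R\<close> unfolding transit_sets_def axiom_a'_def by blast
  have Int: "A \<inter> B \<in> ?C" if AB: "A \<in> ?C" "B \<in> ?C" for A B
  proof (cases "A \<inter> B = {}")
    case False
    then have "A \<in> transit_sets V R" "B \<in> transit_sets V R"
      using AB by auto
    then obtain u v x y where uv: "u \<in> V" "v \<in> V" "A = R u v"
        and xy: "x \<in> V" "y \<in> V" "B = R x y"
      unfolding transit_sets_def by blast
    then obtain p q where "p \<in> V" "q \<in> V" "A \<inter> B = R p q"
      using k False unfolding axiom_k_def by metis
    then show ?thesis unfolding transit_sets_def by blast
  qed simp
  have "\<Inter>F \<in> ?C" if "F \<subseteq> ?C" "F \<noteq> {}" for F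
  proof -
    have "finite F"
      using that(1) sub \<open>finite V\<close> by (meson finite_Pow_iff finite_subset)
    then show ?thesis
      using that(2,1)
    proof (induction rule: finite_ne_induct)
      case (insert A F)
      then have "A \<in> ?C" "\<Inter>F \<in> ?C"
        by (simp_all only: insert_subset)
      then have "A \<inter> \<Inter>F \<in> ?C" by (rule Int)
      then show ?case by simp
    qed simp
  qed
  then show ?thesis
    using sub V unfolding convexity_def by simp
qed

lemma insert_transit_set_iff:
  assumes tf: "transit_function V R" and mono: "monotone_transit V R"
    and xy: "x \<in> V" "y \<in> V" and w: "w \<in> V - R x y"
  shows "insert w (R x y) \<in> transit_sets V R \<longleftrightarrow> (\<exists>z\<in>R x y. insert w (R x y) = R w z)"
proof
  have xR: "x \<in> R x y" and subV: "R x y \<subseteq> V"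
    using tf xy unfolding transit_function_def by auto
  {
    assume "insert w (R x y) \<in> transit_sets V R"
    then obtain p q where pq: "p \<in> V" "q \<in> V" and eq: "insert w (R x y) = R p q"
      unfolding transit_sets_def by auto
    have mem: "p \<in> R p q" "q \<in> R p q" and comm: "R p q = R q p"
      using tf pq unfolding transit_function_def by blast+
    \<comment> \<open>Monotonicity would put \<open>R p q\<close>, and with it \<open>w\<close>,
      inside \<open>R x y\<close>.\<close>
    have "\<not> (p \<in> R x y \<and> q \<in> R x y)"
      using mono xy pq eq w unfolding monotone_transit_def by blast
    \<comment> \<open>The set \<open>R w w\<close> is a singleton, but \<open>R p q\<close> also
      contains \<open>x\<close>, which differs from \<open>w\<close>.\<close>
    moreover have "\<not> (p = w \<and> q = w)"
    proof
      assume "p = w \<and> q = w"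
      then have "R p q = {w}"
        using tf w unfolding transit_function_def by auto
      then show False using eq xR w by auto
    qed
    ultimately have "p = w \<and> q \<in> R x y \<or> q = w \<and> p \<in> R x y"
      using mem eq by blast
    then show "\<exists>z\<in>R x y. insert w (R x y) = R w z"
      using eq comm by auto
  next
    assume "\<exists>z\<in>R x y. insert w (R x y) = R w z"
    then show "insert w (R x y) \<in> transit_sets V R"
      using w subV unfolding transit_sets_def by blast
  }
qed

theorem theorem4p5:
  fixes V :: "'a set" and R :: "'a \<Rightarrow> 'a \<Rightarrow> 'a set"
  assumes "finite V" and "V \<noteq> {}"
    and "transit_function V R"
    and "monotone_transit V R"
    and "axiom_a' V R"
    and "axiom_k V R"
  shows "convex_geometry V (transit_sets V R \<union> {{}}) \<longleftrightarrow> axiom_cg V R"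
proof -
  let ?C = "transit_sets V R \<union> {{}}"
  let ?ext = "\<lambda>K. K \<noteq> V \<longrightarrow> (\<exists>w\<in>V - K. insert w K \<in> ?C)"
  \<comment> \<open>Axiom (cg) speaks of transit sets only, so the empty convex set is extended
    separately, by the singleton \<open>R v v\<close>.\<close>
  obtain v where v: "v \<in> V" using \<open>V \<noteq> {}\<close> by blast
  then have "R v v = {v}"
    using assms(3) unfolding transit_function_def by blast
  then have "{v} \<in> ?C"
    using v unfolding transit_sets_def by blast
  then have empty: "?ext {}" using v by blast
  have "convex_geometry V ?C \<longleftrightarrow> (\<forall>K\<in>?C. ?ext K)"
    using assms by (intro convex_geometry_iff_extension convexity_transit_sets)
  also have "\<dots> \<longleftrightarrow> (\<forall>K\<in>transit_sets V R. ?ext K)"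
    using empty by blast
  also have "\<dots> \<longleftrightarrow> (\<forall>x\<in>V. \<forall>y\<in>V. ?ext (R x y))"
    by (rule ball_transit_sets)
  also have "\<dots> \<longleftrightarrow> axiom_cg V R"
    unfolding axiom_cg_def
  proof (intro ball_cong refl imp_cong)
    fix x y assume xy: "x \<in> V" "y \<in> V"
    \<comment> \<open>An inserted set is nonempty, so it lies in \<open>?C\<close> exactly when it
      is a transit set.\<close>
    have "insert w (R x y) \<in> ?C \<longleftrightarrow> (\<exists>z\<in>R x y. R x y \<union> {w} = R w z)" if "w \<in> V - R x y" for w
      using insert_transit_set_iff[OF assms(3,4) xy that] by simp
    then show "(\<exists>w\<in>V - R x y. insert w (R x y) \<in> ?C) \<longleftrightarrow>
        (\<exists>z\<in>R x y. \<exists>w\<in>V - R x y. R x y \<union> {w} = R w z)"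
      by (metis (no_types, lifting))
  qed
  finally show ?thesis .
qed

end
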